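(* Let $q$ be a prime power and let $g(n,r)$ denote the number of $n\times n$ matrices over $\mathbf{F}_q$ of rank $r$ with all diagonal entries equal to zero. For $n\ge1$ and $r\ge0$, $$g(n+1,r+1)=(q^n-q^{r-1})^2\,g(n,r-1)+(q^{2r+1}+q^{r+1}-q^r)\,g(n,r+1)+(2q^{n+r}-q^{2r}-q^{2r-1}-q^r+q^{r-1})\,g(n,r),$$ with initial conditions $g(n,0)=1$, $g(n,-1)=0$ and $g(1,1)=0$.
   Context: $\mathbf{F}_q$ is the field with $q$ elements. *)

theory Defs
  imports "Jordan_Normal_Form.DL_Rank" "HOL-Library.Cardinality"
begin

text \<open>The field with \<open>q\<close> elements is a finite field type \<open>'a\<close> with \<open>CARD('a) = q\<close>, passed as an
  \<open>itself\<close> argument. The rank argument is an integer, so that the value at rank \<open>-1\<close> is defined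
  (and is a count like any other).\<close>

definition zero_diag_mats :: "'a::{field,finite} itself \<Rightarrow> nat \<Rightarrow> int \<Rightarrow> 'a mat set" where
  "zero_diag_mats F n r =
     {A \<in> carrier_mat n n. (\<forall>i<n. A $$ (i, i) = 0) \<and> int (vec_space.rank n A) = r}"

definition zero_diag_count :: "'a::{field,finite} itself \<Rightarrow> nat \<Rightarrow> int \<Rightarrow> nat" where
  "zero_diag_count F n r = card (zero_diag_mats F n r)"

end

theory Submission
  imports Defs "Berlekamp_Zassenhaus.Berlekamp_Type_Based"
begin

text \<open>
  An \<open>(n + 1) \<times> (n + 1)\<close> matrix with zero diagonal is the same thing as an \<open>n \<times> n\<close> matrix \<open>A\<close> with
  zero diagonal bordered by a column \<open>b\<close>, a row \<open>c\<close> and a corner entry \<open>0\<close>. The recurrence holds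
  because the number of borders \<open>(b, c)\<close> that produce a given rank depends only on \<open>s = rank A\<close>:

  \<^item> if \<open>b\<close> is outside the column space of \<open>A\<close> and \<open>c\<close> does not annihilate the kernel of \<open>A\<close>, the rank
    grows by \<open>2\<close>; there are \<open>(q\<^sup>n - q\<^sup>s)\<^sup>2\<close> such borders;
  \<^item> if \<open>b = A x\<close>, \<open>c\<close> annihilates the kernel and \<open>c \<bullet> x = 0\<close> (a condition on \<open>b\<close> and \<open>c\<close> alone, since
    \<open>c\<close> kills the ambiguity of \<open>x\<close>), the rank does not change. The pairing \<open>(A x, c) \<mapsto> c \<bullet> x\<close> is a
    nondegenerate bilinear form on two spaces of dimension \<open>s\<close>, so it vanishes on
    \<open>q\<^sup>s + (q\<^sup>s - 1) q\<^sup>s / q\<close> pairs;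
  \<^item> in all other cases the rank grows by \<open>1\<close>.

  Summing over \<open>A\<close> with \<open>s = r - 1\<close>, \<open>s = r + 1\<close> and \<open>s = r\<close> gives the three terms of the recurrence.

  Over a finite field all linear algebra can be done by counting. The column space has \<open>q\<^sup>s\<close> elements
  (\<open>card_col_space\<close>), so the kernel size determines the rank (\<open>rank_eqI\<close>), and the kernel of the bordered
  matrix is found by solving its two block equations. The one tool for the counts is that a
  nonzero linear functional takes every value equally often (\<open>card_level_set\<close>); double counting with it
  also gives the size of an annihilator (\<open>card_orthogonal_complement\<close>).
\<close>

section \<open>Subspaces and linear functionals over a finite field\<close>

lemma submodule_vec_iff:
  "submodule class_ring K (module_vec TYPE('a::field) n) \<longleftrightarrow>
     K \<subseteq> carrier_vec n \<and> 0\<^sub>v n \<in> K \<and> (\<forall>v\<in>K. \<forall>w\<in>K. v + w \<in> K) \<and> (\<forall>a. \<forall>v\<in>K. a \<cdot>\<^sub>v v \<in> K)"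
proof -
  show ?thesis
    using vec_module[of n, where ?'a = 'a]
    by (auto simp: submodule_def module_vec_simps class_ring_simps)
qed

lemma add_right_cancel_vec:
  fixes u v w :: "'a::group_add vec"
  assumes "u \<in> carrier_vec n" "v \<in> carrier_vec n" "w \<in> carrier_vec n"
  shows "u + w = v + w \<longleftrightarrow> u = v"
proof
  assume eq: "u + w = v + w"
  show "u = v"
  proof (rule eq_vecI)
    fix i assume "i < dim_vec v"
    then have "(u + w) $ i = u $ i + w $ i" "(v + w) $ i = v $ i + w $ i"
      using assms by auto
    then show "u $ i = v $ i" using eq by simp
  qed (use assms in auto)
qed simp

text \<open>Every vector has a unique coordinate function with respect to a basis.\<close>
lemma card_vectorspace:
  assumes "vectorspace K V" "vectorspace.fin_dim K V"
  shows "card (carrier V) = card (carrier K) ^ vectorspace.dim K V"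
proof -
  interpret vectorspace K V by fact
  obtain B where B: "finite B" "basis B"
    using finite_basis_exists[OF assms(2)] by blast
  then have BV: "B \<subseteq> carrier V" by (simp add: basis_def)
  have uniq: "\<exists>!a. a \<in> B \<rightarrow>\<^sub>E carrier K \<and> lincomb a B = v" if "v \<in> carrier V" for v
    using basis_criterion[OF B(1) BV] B(2) that by blast
  have "lincomb a B \<in> carrier V" if "a \<in> B \<rightarrow>\<^sub>E carrier K" for a
    using that BV by (intro lincomb_closed) auto
  then have "bij_betw (\<lambda>a. lincomb a B) (B \<rightarrow>\<^sub>E carrier K) (carrier V)"
    unfolding bij_betw_def inj_on_def using uniq by blast
  then have "card (carrier V) = card (B \<rightarrow>\<^sub>E carrier K)"
    by (simp add: bij_betw_same_card)
  then show ?thesis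
    using B by (simp add: card_PiE dim_basis)
qed

lemma card_col_space:
  fixes A :: "'a::{field,finite} mat"
  assumes A: "A \<in> carrier_mat n m"
  shows "card (vec_space.col_space n A) = CARD('a) ^ vec_space.rank n A"
proof -
  interpret vec_space "TYPE('a)" n .
  have cols: "set (cols A) \<subseteq> carrier_vec n"
    using A cols_dim by blast
  have "vectorspace class_ring (span_vs (set (cols A)))"
    using cols span_is_subspace subspace_is_vs by auto
  from card_vectorspace[OF this fin_dim_span_cols[OF A]] show ?thesis
    by (simp add: rank_def col_space_def class_ring_simps)
qed

lemma col_space_eq_image:
  fixes A :: "'a::field mat"
  assumes A: "A \<in> carrier_mat n m"
  shows "vec_space.col_space n A = (\<lambda>x. A *\<^sub>v x) ` carrier_vec m"
  using A by (auto simp: vec_space.col_space_eq[OF A])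

lemma submodule_col_space:
  fixes A :: "'a::field mat"
  assumes A: "A \<in> carrier_mat n m"
  shows "submodule class_ring (vec_space.col_space n A) (module_vec TYPE('a) n)"
proof -
  interpret vec_space "TYPE('a)" n .
  show ?thesis
    unfolding col_space_def using cols_dim[of A] A by (intro span_is_submodule) auto
qed

lemma submodule_mat_kernel:
  fixes A :: "'a::field mat"
  assumes A: "A \<in> carrier_mat n m"
  shows "submodule class_ring (mat_kernel A) (module_vec TYPE('a) m)"
  using assms mat_kernel_smult[OF A]
  by (auto simp: submodule_vec_iff mat_kernel[OF A] mult_add_distrib_mat_vec[OF A] mult_mat_vec[OF A])

lemma submodule_orthogonal_complement:
  fixes K :: "'a::field vec set"
  assumes "K \<subseteq> carrier_vec n"
  shows "submodule class_ring (vec_module.orthogonal_complement n K) (module_vec TYPE('a) n)"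
  using assms
  by (auto simp: submodule_vec_iff vec_module.orthogonal_complement_def subset_iff add_scalar_prod_distrib[of _ n])

lemma finite_submodule_vec:
  fixes K :: "'a::{field,finite} vec set"
  assumes "submodule class_ring K (module_vec TYPE('a) n)"
  shows "finite K"
  using assms finite_subset[OF _ finite_carrier_vec] by (auto simp: submodule_vec_iff)

text \<open>Translation by a multiple of a vector \<open>u\<close> with \<open>f u \<noteq> 0\<close> maps each level set of \<open>f\<close> injectively into
  any other, so the \<open>q\<close> level sets partition \<open>K\<close> into parts of equal size.\<close>
lemma card_level_set:
  fixes K :: "'a::{field,finite} vec set"
  assumes K: "submodule class_ring K (module_vec TYPE('a) n)"
    and add: "\<And>v w. v \<in> K \<Longrightarrow> w \<in> K \<Longrightarrow> f (v + w) = f v + f w"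
    and smult: "\<And>a v. v \<in> K \<Longrightarrow> f (a \<cdot>\<^sub>v v) = a * f v"
    and u: "u \<in> K" "f u \<noteq> 0"
  shows "CARD('a) * card {v \<in> K. f v = a} = card K"
proof -
  note K' = K[unfolded submodule_vec_iff]
  have fin: "finite K" by (rule finite_submodule_vec[OF K])
  have le: "card {v \<in> K. f v = a} \<le> card {v \<in> K. f v = b}" for a b
  proof (rule card_inj_on_le)
    define w where "w = ((b - a) / f u) \<cdot>\<^sub>v u"
    have w: "w \<in> K" "f w = b - a" using K' u smult by (auto simp: w_def)
    show "inj_on (\<lambda>v. v + w) {v \<in> K. f v = a}"
    proof (rule inj_onI)
      fix v v' assume *: "v \<in> {v \<in> K. f v = a}" "v' \<in> {v \<in> K. f v = a}" "v + w = v' + w"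
      then have "v \<in> carrier_vec n" "v' \<in> carrier_vec n" "w \<in> carrier_vec n"
        using K' w by auto
      then show "v = v'" using *(3) by (metis add_right_cancel_vec)
    qed
    show "(\<lambda>v. v + w) ` {v \<in> K. f v = a} \<subseteq> {v \<in> K. f v = b}"
      using K' w add by auto
    show "finite {v \<in> K. f v = b}" using fin by simp
  qed
  have eq: "card {v \<in> K. f v = b} = card {v \<in> K. f v = a}" for b
    using le by (simp add: antisym)
  have "K = (\<Union>b. {v \<in> K. f v = b})" by auto
  then have "card K = card (\<Union>b. {v \<in> K. f v = b})" by simp
  also have "\<dots> = (\<Sum>b\<in>UNIV. card {v \<in> K. f v = b})"
    using fin by (intro card_UN_disjoint) auto
  also have "\<dots> = (\<Sum>b\<in>(UNIV :: 'a set). card {v \<in> K. f v = a})"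
    by (intro sum.cong eq refl)
  finally show ?thesis by simp
qed


lemma ex_scalar_prod_neq_0:
  fixes c :: "'a::field vec"
  assumes "c \<in> carrier_vec n" "c \<noteq> 0\<^sub>v n"
  obtains u where "u \<in> carrier_vec n" "c \<bullet> u \<noteq> 0"
proof -
  obtain i where "i < n" "c $ i \<noteq> 0"
    using assms by (metis carrier_vecD eq_vecI index_zero_vec)
  then show thesis
    using that[of "unit_vec n i"] assms by simp
qed

lemma submodule_carrier_vec:
  "submodule class_ring (carrier_vec n) (module_vec TYPE('a::field) n)"
  by (simp add: submodule_vec_iff)

lemma card_hyperplane:
  fixes K :: "'a::{field,finite} vec set"
  assumes K: "submodule class_ring K (module_vec TYPE('a) n)"
    and c: "c \<in> carrier_vec n" "c \<notin> vec_module.orthogonal_complement n K"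
  shows "CARD('a) * card {y \<in> K. c \<bullet> y = a} = card K"
proof -
  have KV: "K \<subseteq> carrier_vec n" using K by (simp add: submodule_vec_iff)
  obtain u where "u \<in> K" "c \<bullet> u \<noteq> 0"
    using c by (auto simp: vec_module.orthogonal_complement_def)
  then show ?thesis
    using c KV by (intro card_level_set[OF K, of _ u]) (auto simp: scalar_prod_add_distrib[of _ n] subset_iff)
qed

lemma two_le_card_field: "CARD('a::{field,finite}) \<ge> 2"
proof -
  have "card {0, 1 :: 'a} \<le> CARD('a)" by (intro card_mono) auto
  then show ?thesis by simp
qed

text \<open>The double counts below sum a function that takes one value on a subset and another value off
  it. The larger value is given as an increment \<open>k\<close> to avoid subtraction of natural numbers.\<close>
lemma sum_two_valued:
  fixes h :: "'b \<Rightarrow> nat"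
  assumes "finite X" "Y \<subseteq> X" and h: "\<And>x. x \<in> X \<Longrightarrow> h x = m + (if x \<in> Y then k else 0)"
  shows "sum h X = card X * m + card Y * k"
proof -
  have "sum h X = (\<Sum>x\<in>X. m + (if x \<in> Y then k else 0))"
    using h by (intro sum.cong) auto
  also have "\<dots> = card X * m + card (X \<inter> Y) * k"
    using assms(1) by (simp add: sum.distrib sum.If_cases)
  finally show ?thesis using assms(2) by (simp add: Int_absorb1)
qed

text \<open>Count the pairs \<open>(c, y)\<close> with \<open>y \<in> K\<close> and \<open>c \<bullet> y = 0\<close> in two ways. For fixed \<open>c\<close> the solutions \<open>y\<close> fill
  \<open>K\<close> or a \<open>q\<close>-th of it, according to whether \<open>c\<close> is in the complement; for fixed \<open>y\<close> the solutions \<open>c\<close> fill the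
  whole space or a \<open>q\<close>-th of it, according to whether \<open>y\<close> is zero.\<close>
lemma card_orthogonal_complement:
  fixes K :: "'a::{field,finite} vec set"
  assumes K: "submodule class_ring K (module_vec TYPE('a) n)"
  shows "card (vec_module.orthogonal_complement n K) * card K = CARD('a) ^ n"
proof -
  let ?q = "CARD('a)" and ?V = "carrier_vec n :: 'a vec set"
  define L where "L = vec_module.orthogonal_complement n K"
  have LV: "L \<subseteq> ?V" by (auto simp: L_def vec_module.orthogonal_complement_def)
  have KV: "K \<subseteq> ?V" and K0: "0\<^sub>v n \<in> K" using K by (simp_all add: submodule_vec_iff)
  have finK: "finite K" by (rule finite_submodule_vec[OF K])
  obtain p where p: "?q = Suc p" "p > 0"
    using two_le_card_field[where ?'a = 'a] by (cases "?q") auto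
  have "?q * card {y \<in> K. c \<bullet> y = 0} = card K + (if c \<in> L then p * card K else 0)"
    if "c \<in> ?V" for c
  proof (cases "c \<in> L")
    case True
    then have "{y \<in> K. c \<bullet> y = 0} = K" by (auto simp: L_def vec_module.orthogonal_complement_def)
    then show ?thesis using True by (simp add: p(1))
  next
    case False
    then show ?thesis using card_hyperplane[OF K that, of 0] by (simp add: L_def)
  qed
  then have l: "(\<Sum>c\<in>?V. ?q * card {y \<in> K. c \<bullet> y = 0}) = card ?V * card K + card L * (p * card K)"
    by (intro sum_two_valued LV) auto
  have "?q * card {c \<in> ?V. c \<bullet> y = 0} = card ?V + (if y \<in> {0\<^sub>v n} then p * card ?V else 0)"
    if y: "y \<in> K" for y
  proof (cases "y = 0\<^sub>v n")
    case True
    then have "{c \<in> ?V. c \<bullet> y = 0} = ?V" by auto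
    then show ?thesis using True by (simp add: p(1))
  next
    case False
    have yV: "y \<in> ?V" using y KV by auto
    obtain u where "u \<in> ?V" "y \<bullet> u \<noteq> 0" using ex_scalar_prod_neq_0[OF yV False] .
    then have "y \<notin> vec_module.orthogonal_complement n ?V"
      by (auto simp: vec_module.orthogonal_complement_def)
    then have "?q * card {c \<in> ?V. y \<bullet> c = 0} = card ?V"
      by (rule card_hyperplane[OF submodule_carrier_vec yV])
    moreover have "{c \<in> ?V. y \<bullet> c = 0} = {c \<in> ?V. c \<bullet> y = 0}"
      using yV comm_scalar_prod by fastforce
    ultimately show ?thesis using False by simp
  qed
  then have r: "(\<Sum>y\<in>K. ?q * card {c \<in> ?V. c \<bullet> y = 0}) = card K * card ?V + card {0\<^sub>v n :: 'a vec} * (p * card ?V)"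
    using K0 finK by (intro sum_two_valued) auto
  have "card ?V * card K + card L * (p * card K) = card K * card ?V + p * card ?V"
    using l r sum_multicount_gen[of ?V K "\<lambda>c y. c \<bullet> y = 0" "\<lambda>y. card {c \<in> ?V. c \<bullet> y = 0}"] finK
    by (simp flip: sum_distrib_left)
  then have "p * (card L * card K) = p * card ?V" by (simp add: algebra_simps)
  then show ?thesis using p by (simp add: card_carrier_vec L_def)
qed

section \<open>Kernel size and rank\<close>

lemma minus_in_kernel_iff:
  fixes A :: "'a::field mat"
  assumes A: "A \<in> carrier_mat n m" and x: "x \<in> carrier_vec m" "y \<in> carrier_vec m"
  shows "x - y \<in> mat_kernel A \<longleftrightarrow> A *\<^sub>v x = A *\<^sub>v y"
proof -
  have "A *\<^sub>v (x - y) = A *\<^sub>v x - A *\<^sub>v y"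
    using mult_minus_distrib_mat_vec[OF A x] .
  moreover have "A *\<^sub>v x - A *\<^sub>v y = 0\<^sub>v n \<longleftrightarrow> A *\<^sub>v x = A *\<^sub>v y"
  proof
    assume eq: "A *\<^sub>v x - A *\<^sub>v y = 0\<^sub>v n"
    show "A *\<^sub>v x = A *\<^sub>v y"
    proof (rule eq_vecI)
      fix i assume "i < dim_vec (A *\<^sub>v y)"
      then have i: "i < n" using A by simp
      then have "(A *\<^sub>v x - A *\<^sub>v y) $ i = (A *\<^sub>v x) $ i - (A *\<^sub>v y) $ i"
        using A by simp
      then show "(A *\<^sub>v x) $ i = (A *\<^sub>v y) $ i" using eq i by simp
    qed simp
  qed (use mult_mat_vec_carrier[OF A x(2)] in simp)
  ultimately show ?thesis
    using x by (simp add: mat_kernel[OF A])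
qed

text \<open>Rank-nullity in multiplicative form: the fibres of \<open>x \<mapsto> A x\<close> over the column space are translates
  of the kernel.\<close>
lemma card_mat_kernel:
  fixes A :: "'a::{field,finite} mat"
  assumes A: "A \<in> carrier_mat n m"
  shows "card (mat_kernel A) * CARD('a) ^ vec_space.rank n A = CARD('a) ^ m"
proof -
  let ?V = "carrier_vec m :: 'a vec set"
  define I where "I = vec_space.col_space n A"
  have I: "I = (\<lambda>x. A *\<^sub>v x) ` ?V"
    unfolding I_def by (rule col_space_eq_image[OF A])
  have fibre: "card {x \<in> ?V. A *\<^sub>v x = b} = card (mat_kernel A)" if "b \<in> I" for b
  proof -
    obtain x0 where x0: "x0 \<in> ?V" "A *\<^sub>v x0 = b" using \<open>b \<in> I\<close> I by auto
    have "bij_betw (\<lambda>x. x - x0) {x \<in> ?V. A *\<^sub>v x = b} (mat_kernel A)"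
    proof (rule bij_betw_byWitness[where f' = "\<lambda>y. y + x0"])
      show "(\<lambda>x. x - x0) ` {x \<in> ?V. A *\<^sub>v x = b} \<subseteq> mat_kernel A"
        using x0 minus_in_kernel_iff[OF A _ x0(1)] by auto
      show "(\<lambda>y. y + x0) ` mat_kernel A \<subseteq> {x \<in> ?V. A *\<^sub>v x = b}"
        using x0 A by (auto simp: mat_kernel[OF A] mult_add_distrib_mat_vec[OF A])
    qed (use x0 in \<open>auto simp: mat_kernel[OF A]\<close>)
    then show ?thesis by (rule bij_betw_same_card)
  qed
  have "?V = (\<Union>b\<in>I. {x \<in> ?V. A *\<^sub>v x = b})" using I by auto
  then have "card ?V = card (\<Union>b\<in>I. {x \<in> ?V. A *\<^sub>v x = b})" by simp
  also have "\<dots> = (\<Sum>b\<in>I. card {x \<in> ?V. A *\<^sub>v x = b})"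
    using I by (intro card_UN_disjoint) auto
  also have "\<dots> = (\<Sum>b\<in>I. card (mat_kernel A))" by (intro sum.cong fibre refl)
  finally show ?thesis
    using card_col_space[OF A] by (simp add: card_carrier_vec I_def mult.commute)
qed


lemma rank_eqI:
  fixes A :: "'a::{field,finite} mat"
  assumes A: "A \<in> carrier_mat n m" and "card (mat_kernel A) * CARD('a) ^ k = CARD('a) ^ m"
  shows "vec_space.rank n A = k"
proof -
  have "card (mat_kernel A) * CARD('a) ^ k = card (mat_kernel A) * CARD('a) ^ vec_space.rank n A"
    using assms(2) card_mat_kernel[OF A] by simp
  moreover have "card (mat_kernel A) \<noteq> 0"
    using assms(2) by (intro notI) simp
  ultimately have "CARD('a) ^ k = CARD('a) ^ vec_space.rank n A" by simp
  then show ?thesis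
    using two_le_card_field[where ?'a = 'a] by (simp add: power_inject_exp)
qed

section \<open>The kernel of a bordered matrix\<close>

definition snoc_vec :: "'a vec \<Rightarrow> 'a \<Rightarrow> 'a vec" where
  "snoc_vec x t = vec (Suc (dim_vec x)) (\<lambda>i. if i < dim_vec x then x $ i else t)"

definition border_mat :: "'a::zero mat \<Rightarrow> 'a vec \<Rightarrow> 'a vec \<Rightarrow> 'a mat" where
  "border_mat A b c = mat (Suc (dim_row A)) (Suc (dim_col A))
     (\<lambda>(i, j). if i < dim_row A then if j < dim_col A then A $$ (i, j) else b $ i
               else if j < dim_col A then c $ j else 0)"

lemma bij_betw_snoc_vec:
  "bij_betw (\<lambda>(x, t). snoc_vec x t) (carrier_vec n \<times> UNIV) (carrier_vec (Suc n))"
proof (rule bij_betw_byWitness[where f' = "\<lambda>v. (vec n (\<lambda>i. v $ i), v $ n)"])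
  show "\<forall>v\<in>carrier_vec (Suc n). (case (vec n (\<lambda>i. v $ i), v $ n) of (x, t) \<Rightarrow> snoc_vec x t) = v"
    by (auto simp: snoc_vec_def less_Suc_eq intro!: eq_vecI)
qed (auto simp: snoc_vec_def intro!: eq_vecI)

lemma border_mat_carrier:
  "A \<in> carrier_mat n m \<Longrightarrow> border_mat A b c \<in> carrier_mat (Suc n) (Suc m)"
  by (auto simp: border_mat_def)

lemma border_mat_mult_snoc_vec:
  fixes A :: "'a::field mat"
  assumes "A \<in> carrier_mat n m" "b \<in> carrier_vec n" "c \<in> carrier_vec m" "x \<in> carrier_vec m"
  shows "border_mat A b c *\<^sub>v snoc_vec x t = snoc_vec (A *\<^sub>v x + t \<cdot>\<^sub>v b) (c \<bullet> x)"
proof (rule eq_vecI)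
  fix i assume "i < dim_vec (snoc_vec (A *\<^sub>v x + t \<cdot>\<^sub>v b) (c \<bullet> x))"
  then have i: "i < Suc n" using assms by (simp add: snoc_vec_def)
  have "(border_mat A b c *\<^sub>v snoc_vec x t) $ i =
      (\<Sum>j = 0..<Suc m. border_mat A b c $$ (i, j) * snoc_vec x t $ j)"
    using assms i by (simp add: scalar_prod_def border_mat_def snoc_vec_def)
  also have "\<dots> = (\<Sum>j = 0..<m. border_mat A b c $$ (i, j) * snoc_vec x t $ j) + border_mat A b c $$ (i, m) * t"
    using assms by (simp add: snoc_vec_def)
  also have "\<dots> = snoc_vec (A *\<^sub>v x + t \<cdot>\<^sub>v b) (c \<bullet> x) $ i"
    using assms i by (auto simp: less_Suc_eq snoc_vec_def border_mat_def scalar_prod_def mult.commute)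
  finally show "(border_mat A b c *\<^sub>v snoc_vec x t) $ i = snoc_vec (A *\<^sub>v x + t \<cdot>\<^sub>v b) (c \<bullet> x) $ i" .
qed (use assms in \<open>auto simp: snoc_vec_def border_mat_def\<close>)

lemma snoc_vec_eq_0_iff:
  assumes "x \<in> carrier_vec n"
  shows "snoc_vec x t = 0\<^sub>v (Suc n) \<longleftrightarrow> x = 0\<^sub>v n \<and> t = 0"
proof -
  have "snoc_vec x t = 0\<^sub>v (Suc n) \<longleftrightarrow> (\<forall>i<Suc n. (if i < n then x $ i else t) = 0)"
    using assms by (simp add: snoc_vec_def vec_eq_iff)
  also have "\<dots> \<longleftrightarrow> (\<forall>i<n. x $ i = 0) \<and> t = 0"
    by (auto simp: less_Suc_eq)
  finally show ?thesis
    using assms by (simp add: vec_eq_iff)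
qed

lemma card_kernel_border_mat:
  fixes A :: "'a::field mat"
  assumes A: "A \<in> carrier_mat n m" and b: "b \<in> carrier_vec n" and c: "c \<in> carrier_vec m"
  shows "card (mat_kernel (border_mat A b c)) =
    card {(x, t). x \<in> carrier_vec m \<and> A *\<^sub>v x + t \<cdot>\<^sub>v b = 0\<^sub>v n \<and> c \<bullet> x = 0}" (is "_ = card ?S")
proof -
  have iff: "snoc_vec x t \<in> mat_kernel (border_mat A b c) \<longleftrightarrow> (x, t) \<in> ?S" if x: "x \<in> carrier_vec m" for x t
  proof -
    have "A *\<^sub>v x + t \<cdot>\<^sub>v b \<in> carrier_vec n" using A b x by auto
    moreover have "snoc_vec x t \<in> carrier_vec (Suc m)" using x by (simp add: snoc_vec_def)
    ultimately show ?thesis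
      using x by (simp add: mat_kernel[OF border_mat_carrier[OF A]] border_mat_mult_snoc_vec[OF A b c x]
          snoc_vec_eq_0_iff)
  qed
  have "inj_on (\<lambda>(x, t). snoc_vec x t) ?S"
    by (rule inj_on_subset[OF bij_betw_imp_inj_on[OF bij_betw_snoc_vec[of m]]]) auto
  moreover have "(\<lambda>(x, t). snoc_vec x t) ` ?S = mat_kernel (border_mat A b c)"
  proof (intro equalityI subsetI)
    fix v assume v: "v \<in> mat_kernel (border_mat A b c)"
    then have "v \<in> carrier_vec (Suc m)" using mat_kernel_carrier[OF border_mat_carrier[OF A]] by blast
    then obtain x t where "x \<in> carrier_vec m" "v = snoc_vec x t"
      using bij_betw_imp_surj_on[OF bij_betw_snoc_vec[where ?'a = 'a and n = m], symmetric] by auto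
    then show "v \<in> (\<lambda>(x, t). snoc_vec x t) ` ?S" using v iff by auto
  qed (use iff in auto)
  ultimately show ?thesis by (metis (no_types, lifting) card_image)
qed

text \<open>A functional that annihilates the kernel of \<open>A\<close> factors through \<open>A\<close>; this is what makes the pairing of
  a vector \<open>A x\<close> with \<open>c\<close> by \<open>c \<bullet> x\<close> well defined.\<close>
lemma orthogonal_kernel_scalar_prod_cong:
  fixes A :: "'a::field mat"
  assumes A: "A \<in> carrier_mat n m" and c: "c \<in> vec_module.orthogonal_complement m (mat_kernel A)"
    and x: "x \<in> carrier_vec m" "y \<in> carrier_vec m" "A *\<^sub>v x = A *\<^sub>v y"
  shows "c \<bullet> x = c \<bullet> y"
proof -
  have "c \<bullet> (x - y) = 0"
    using minus_in_kernel_iff[OF A x(1,2)] x(3) c by (auto simp: vec_module.orthogonal_complement_def)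
  then show ?thesis
    using c x by (simp add: vec_module.orthogonal_complement_def scalar_prod_minus_distrib[of _ m])
qed

text \<open>A solution of \<open>A x + t b = 0\<close> with \<open>t \<noteq> 0\<close> would put \<open>b\<close> into the column space, so the last coordinate
  of a kernel vector is \<open>0\<close>.\<close>
lemma card_kernel_border_mat_outside:
  fixes A :: "'a::{field,finite} mat"
  assumes A: "A \<in> carrier_mat n m" and b: "b \<in> carrier_vec n" and c: "c \<in> carrier_vec m"
    and bI: "b \<notin> vec_space.col_space n A"
  shows "card (mat_kernel (border_mat A b c)) = card {x \<in> mat_kernel A. c \<bullet> x = 0}"
proof -
  have t0: "t = 0" if x: "x \<in> carrier_vec m" and eq: "A *\<^sub>v x + t \<cdot>\<^sub>v b = 0\<^sub>v n" for x t
  proof (rule ccontr)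
    assume "t \<noteq> 0"
    have "b = A *\<^sub>v ((- (1 / t)) \<cdot>\<^sub>v x)"
    proof (rule eq_vecI)
      fix i assume "i < dim_vec (A *\<^sub>v ((- (1 / t)) \<cdot>\<^sub>v x))"
      then have i: "i < n" using A by simp
      have "(A *\<^sub>v x + t \<cdot>\<^sub>v b) $ i = 0" using eq i by simp
      then have "(A *\<^sub>v x) $ i + t * b $ i = 0" using A b i by simp
      then have "b $ i = - (1 / t) * (A *\<^sub>v x) $ i"
        using \<open>t \<noteq> 0\<close> by (simp add: field_simps eq_neg_iff_add_eq_0)
      then show "b $ i = (A *\<^sub>v ((- (1 / t)) \<cdot>\<^sub>v x)) $ i"
        using A x i by (simp add: mult_mat_vec[OF A x])
    qed (use A b in simp)
    then show False
      using bI x by (auto simp: col_space_eq_image[OF A])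
  qed
  \<comment> \<open>With \<open>t = 0\<close> the block equations reduce to \<open>A x = 0\<close> and \<open>c \<bullet> x = 0\<close>.\<close>
  have "{(x, t). x \<in> carrier_vec m \<and> A *\<^sub>v x + t \<cdot>\<^sub>v b = 0\<^sub>v n \<and> c \<bullet> x = 0} =
      (\<lambda>x. (x, 0)) ` {x \<in> mat_kernel A. c \<bullet> x = 0}" (is "?S = ?f ` ?T")
  proof (intro equalityI subsetI)
    fix p assume "p \<in> ?S"
    then obtain x t where p: "p = (x, t)" "x \<in> carrier_vec m" "A *\<^sub>v x + t \<cdot>\<^sub>v b = 0\<^sub>v n" "c \<bullet> x = 0"
      by auto
    with t0 have "t = 0" by simp
    have "0 \<cdot>\<^sub>v b = 0\<^sub>v n" "A *\<^sub>v x + 0\<^sub>v n = A *\<^sub>v x" using b A p(2) by auto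
    then show "p \<in> ?f ` ?T" using p \<open>t = 0\<close> by (auto simp: mat_kernel[OF A])
  next
    fix p assume "p \<in> ?f ` ?T"
    moreover have "0 \<cdot>\<^sub>v b = 0\<^sub>v n" using b by auto
    ultimately show "p \<in> ?S" by (auto simp: mat_kernel[OF A])
  qed
  then show ?thesis
    by (simp add: card_kernel_border_mat[OF A b c] card_image inj_on_def)
qed

text \<open>The substitution \<open>y = x + t x0\<close> turns \<open>A x + t (A x0) = 0\<close> into \<open>A y = 0\<close>, and \<open>c \<bullet> x = 0\<close> into
  \<open>c \<bullet> y = t (c \<bullet> x0)\<close>.\<close>
lemma card_kernel_border_mat_inside:
  fixes A :: "'a::{field,finite} mat"
  assumes A: "A \<in> carrier_mat n m" and c: "c \<in> carrier_vec m" and x0: "x0 \<in> carrier_vec m"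
  shows "card (mat_kernel (border_mat A (A *\<^sub>v x0) c)) =
    (\<Sum>t\<in>UNIV. card {y \<in> mat_kernel A. c \<bullet> y = t * (c \<bullet> x0)})"
proof -
  have b: "A *\<^sub>v x0 \<in> carrier_vec n" using A x0 by auto
  let ?S = "{(x, t). x \<in> carrier_vec m \<and> A *\<^sub>v x + t \<cdot>\<^sub>v (A *\<^sub>v x0) = 0\<^sub>v n \<and> c \<bullet> x = 0}"
  let ?T = "SIGMA t:UNIV. {y \<in> mat_kernel A. c \<bullet> y = t * (c \<bullet> x0)}"
  have x0t: "t \<cdot>\<^sub>v x0 \<in> carrier_vec m" for t using x0 by simp
  have lin: "A *\<^sub>v (x + t \<cdot>\<^sub>v x0) = A *\<^sub>v x + t \<cdot>\<^sub>v (A *\<^sub>v x0)"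
    "c \<bullet> (x + t \<cdot>\<^sub>v x0) = c \<bullet> x + t * (c \<bullet> x0)" if x: "x \<in> carrier_vec m" for x t
    unfolding mult_add_distrib_mat_vec[OF A x x0t] mult_mat_vec[OF A x0]
      scalar_prod_add_distrib[OF c x x0t] scalar_prod_smult_distrib[OF c x0] by (rule refl)+
  have shift: "x - t \<cdot>\<^sub>v x0 + t \<cdot>\<^sub>v x0 = x" "x + t \<cdot>\<^sub>v x0 - t \<cdot>\<^sub>v x0 = x"
    if "x \<in> carrier_vec m" for x t using x0 that by (auto intro!: eq_vecI)
  have "bij_betw (\<lambda>(x, t). (t, x + t \<cdot>\<^sub>v x0)) ?S ?T"
  proof (rule bij_betw_byWitness[where f' = "\<lambda>(t, y). (y - t \<cdot>\<^sub>v x0, t)"])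
    show "(\<lambda>(x, t). (t, x + t \<cdot>\<^sub>v x0)) ` ?S \<subseteq> ?T"
      using x0 by (auto simp: mat_kernel[OF A] lin)
    show "(\<lambda>(t, y). (y - t \<cdot>\<^sub>v x0, t)) ` ?T \<subseteq> ?S"
    proof clarify
      fix t y assume y: "y \<in> mat_kernel A" "c \<bullet> y = t * (c \<bullet> x0)"
      define x where "x = y - t \<cdot>\<^sub>v x0"
      have yV: "y \<in> carrier_vec m" "A *\<^sub>v y = 0\<^sub>v n" using y mat_kernel[OF A] by auto
      then have x: "x \<in> carrier_vec m" "x + t \<cdot>\<^sub>v x0 = y" using x0 shift by (auto simp: x_def)
      show "x \<in> carrier_vec m \<and> A *\<^sub>v x + t \<cdot>\<^sub>v (A *\<^sub>v x0) = 0\<^sub>v n \<and> c \<bullet> x = 0"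
        using lin[OF x(1), of t] x yV y(2) by simp
    qed
  qed (auto simp: mat_kernel[OF A] shift)
  then have "card ?S = card ?T" by (rule bij_betw_same_card)
  also have "\<dots> = (\<Sum>t\<in>UNIV. card {y \<in> mat_kernel A. c \<bullet> y = t * (c \<bullet> x0)})"
    using finite_submodule_vec[OF submodule_mat_kernel[OF A]] by (intro card_SigmaI) auto
  finally show ?thesis by (simp add: card_kernel_border_mat[OF A b c])
qed


section \<open>Counting borders by the rank they produce\<close>

lemma card_orthogonal_mat_kernel:
  fixes A :: "'a::{field,finite} mat"
  assumes A: "A \<in> carrier_mat n m"
  shows "card (vec_module.orthogonal_complement m (mat_kernel A)) = CARD('a) ^ vec_space.rank n A"
proof -
  have "card (mat_kernel A) \<noteq> 0"
    using card_mat_kernel[OF A] by (intro notI) simp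
  then show ?thesis
    using card_orthogonal_complement[OF submodule_mat_kernel[OF A]] card_mat_kernel[OF A]
    by (metis mult.commute mult_left_cancel)
qed

text \<open>The zero set of the pairing \<open>(A x, c) \<mapsto> c \<bullet> x\<close> between the column space of \<open>A\<close> and the annihilator of
  its kernel. For invertible \<open>A\<close> these are the borders for which the Schur complement of \<open>A\<close> in the
  bordered matrix vanishes.\<close>
definition isotropic_borders :: "'a::field mat \<Rightarrow> ('a vec \<times> 'a vec) set" where
  "isotropic_borders A = {(b, c). c \<in> vec_module.orthogonal_complement (dim_col A) (mat_kernel A) \<and>
     (\<exists>x\<in>carrier_vec (dim_col A). A *\<^sub>v x = b \<and> c \<bullet> x = 0)}"

text \<open>For fixed \<open>c\<close>, the map \<open>A x \<mapsto> c \<bullet> x\<close> is a linear functional on the column space. It is zero only for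
  \<open>c = 0\<close>, so each of the other \<open>q\<^sup>s - 1\<close> annihilating \<open>c\<close> is paired to \<open>0\<close> with a \<open>q\<close>-th of the column space. The
  equation is stated without division or subtraction, which also covers \<open>s = 0\<close>.\<close>
lemma card_isotropic_borders:
  fixes A :: "'a::{field,finite} mat"
  assumes A: "A \<in> carrier_mat n m"
  defines "q \<equiv> CARD('a)" and "s \<equiv> vec_space.rank n A"
  shows "q * card (isotropic_borders A) + q ^ s = q ^ (2 * s) + q ^ (s + 1)"
proof -
  define L where "L = vec_module.orthogonal_complement m (mat_kernel A)"
  define I where "I = vec_space.col_space n A"
  \<comment> \<open>A preimage of each vector of the column space; on the annihilator of the kernel its choice does not matter.\<close>
  define pre where "pre b = (SOME x. x \<in> carrier_vec m \<and> A *\<^sub>v x = b)" for b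
  have I: "I = (\<lambda>x. A *\<^sub>v x) ` carrier_vec m"
    unfolding I_def by (rule col_space_eq_image[OF A])
  have subI: "submodule class_ring I (module_vec TYPE('a) n)"
    unfolding I_def by (rule submodule_col_space[OF A])
  have cards: "card I = q ^ s" "card L = q ^ s"
    using card_col_space[OF A] card_orthogonal_mat_kernel[OF A] by (simp_all add: I_def L_def q_def s_def)
  have finI: "finite I" by (rule finite_submodule_vec[OF subI])
  have subL: "submodule class_ring L (module_vec TYPE('a) m)"
    unfolding L_def using mat_kernel_carrier[OF A] by (rule submodule_orthogonal_complement)
  have finL: "finite L" by (rule finite_submodule_vec[OF subL])
  have LV: "L \<subseteq> carrier_vec m" "0\<^sub>v m \<in> L" using subL by (auto simp: submodule_vec_iff)
  have pre: "pre b \<in> carrier_vec m" "A *\<^sub>v pre b = b" if "b \<in> I" for b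
    using that someI_ex[of "\<lambda>x. x \<in> carrier_vec m \<and> A *\<^sub>v x = b"] by (auto simp: I pre_def)
  have pre_eq: "c \<bullet> pre (A *\<^sub>v x) = c \<bullet> x" if "c \<in> L" "x \<in> carrier_vec m" for c x
    using that pre[of "A *\<^sub>v x"] I
    by (intro orthogonal_kernel_scalar_prod_cong[OF A]) (auto simp: L_def)
  have fibre: "q * card {b \<in> I. c \<bullet> pre b = 0} = card I + (if c \<in> {0\<^sub>v m} then (q - 1) * card I else 0)"
    if c: "c \<in> L" for c
  proof (cases "c = 0\<^sub>v m")
    case True
    then have "{b \<in> I. c \<bullet> pre b = 0} = I" using pre by auto
    moreover have "q * card I = card I + (q - 1) * card I"
      using two_le_card_field[where ?'a = 'a] by (cases q) (simp_all add: q_def)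
    ultimately show ?thesis using True by simp
  next
    case False
    have cV: "c \<in> carrier_vec m" using c LV by auto
    obtain u where u: "u \<in> carrier_vec m" "c \<bullet> u \<noteq> 0" using ex_scalar_prod_neq_0[OF cV False] .
    have "q * card {b \<in> I. c \<bullet> pre b = 0} = card I"
      unfolding q_def
    proof (rule card_level_set[OF subI])
      fix v w assume "v \<in> I" "w \<in> I"
      then obtain x y where xy: "x \<in> carrier_vec m" "v = A *\<^sub>v x" "y \<in> carrier_vec m" "w = A *\<^sub>v y"
        using I by auto
      then have "v + w = A *\<^sub>v (x + y)" by (simp add: mult_add_distrib_mat_vec[OF A])
      then have "c \<bullet> pre (v + w) = c \<bullet> (x + y)" using pre_eq[OF c, of "x + y"] xy by simp
      then show "c \<bullet> pre (v + w) = c \<bullet> pre v + c \<bullet> pre w"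
        using xy pre_eq[OF c] scalar_prod_add_distrib[OF cV xy(1,3)] by simp
    next
      fix a v assume "v \<in> I"
      then obtain x where x: "x \<in> carrier_vec m" "v = A *\<^sub>v x" using I by auto
      then have "a \<cdot>\<^sub>v v = A *\<^sub>v (a \<cdot>\<^sub>v x)" by (simp add: mult_mat_vec[OF A])
      then have "c \<bullet> pre (a \<cdot>\<^sub>v v) = c \<bullet> (a \<cdot>\<^sub>v x)" using pre_eq[OF c, of "a \<cdot>\<^sub>v x"] x by simp
      then show "c \<bullet> pre (a \<cdot>\<^sub>v v) = a * (c \<bullet> pre v)"
        using x pre_eq[OF c] scalar_prod_smult_distrib[OF cV x(1)] by simp
    next
      show "A *\<^sub>v u \<in> I" using u I by auto
      show "c \<bullet> pre (A *\<^sub>v u) \<noteq> 0" using u pre_eq[OF c] by simp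
    qed
    then show ?thesis using False by simp
  qed
  have "isotropic_borders A = (\<lambda>(c, b). (b, c)) ` (SIGMA c:L. {b \<in> I. c \<bullet> pre b = 0})"
  proof (intro equalityI subsetI)
    fix p assume "p \<in> isotropic_borders A"
    then obtain c x where "p = (A *\<^sub>v x, c)" "c \<in> L" "x \<in> carrier_vec m" "c \<bullet> x = 0"
      using A by (auto simp: isotropic_borders_def L_def)
    then show "p \<in> (\<lambda>(c, b). (b, c)) ` (SIGMA c:L. {b \<in> I. c \<bullet> pre b = 0})"
      using pre_eq I by force
  next
    fix p assume "p \<in> (\<lambda>(c, b). (b, c)) ` (SIGMA c:L. {b \<in> I. c \<bullet> pre b = 0})"
    then show "p \<in> isotropic_borders A"
      using pre A by (auto simp: isotropic_borders_def L_def)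
  qed
  then have "card (isotropic_borders A) = (\<Sum>c\<in>L. card {b \<in> I. c \<bullet> pre b = 0})"
    using finI finL by (simp add: card_image inj_on_def)
  then have "q * card (isotropic_borders A) = (\<Sum>c\<in>L. q * card {b \<in> I. c \<bullet> pre b = 0})"
    by (simp add: sum_distrib_left)
  also have "\<dots> = card L * card I + card {0\<^sub>v m :: 'a vec} * ((q - 1) * card I)"
    using finL LV(2) by (intro sum_two_valued fibre) auto
  finally have "q * card (isotropic_borders A) + q ^ s = q ^ s * q ^ s + (q - 1) * q ^ s + q ^ s"
    by (simp add: cards)
  moreover have "(q - 1) * q ^ s + q ^ s = q ^ (s + 1)"
    using two_le_card_field[where ?'a = 'a] by (cases q) (simp_all add: q_def)
  ultimately show ?thesis by (simp add: mult_2 power_add)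
qed

text \<open>In each case the kernel of the bordered matrix has the size of the kernel of \<open>A\<close> times \<open>q\<close>, \<open>1\<close> or
  \<open>1 / q\<close>. As there is one more column, the rank grows by \<open>0\<close>, \<open>1\<close> or \<open>2\<close> respectively.\<close>
lemma rank_border_mat:
  fixes A :: "'a::{field,finite} mat"
  assumes A: "A \<in> carrier_mat n m" and b: "b \<in> carrier_vec n" and c: "c \<in> carrier_vec m"
  defines "I \<equiv> vec_space.col_space n A"
    and "L \<equiv> vec_module.orthogonal_complement m (mat_kernel A)"
    and "s \<equiv> vec_space.rank n A"
  shows "vec_space.rank (Suc n) (border_mat A b c) =
    (if (b, c) \<in> isotropic_borders A then s else if b \<in> I \<or> c \<in> L then s + 1 else s + 2)"
proof -
  let ?q = "CARD('a)" and ?K = "mat_kernel A" and ?M = "border_mat A b c"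
  note M = border_mat_carrier[OF A, of b c]
  note subK = submodule_mat_kernel[OF A]
  have K: "card ?K * ?q ^ s = ?q ^ m" unfolding s_def by (rule card_mat_kernel[OF A])
  have zero: "{y \<in> ?K. c \<bullet> y = 0} = ?K" if "c \<in> L"
    using that by (auto simp: L_def vec_module.orthogonal_complement_def)
  have level: "?q * card {y \<in> ?K. c \<bullet> y = a} = card ?K" if "c \<notin> L" for a
    using card_hyperplane[OF subK c] that by (simp add: L_def)
  have iso: "(b, c) \<in> isotropic_borders A \<longleftrightarrow> c \<in> L \<and> (\<exists>x\<in>carrier_vec m. A *\<^sub>v x = b \<and> c \<bullet> x = 0)"
    using A by (simp add: isotropic_borders_def L_def)
  show ?thesis
  proof (cases "b \<in> I")
    case False
    then have not_iso: "(b, c) \<notin> isotropic_borders A"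
      using iso by (auto simp: I_def col_space_eq_image[OF A])
    have ker: "card (mat_kernel ?M) = card {x \<in> ?K. c \<bullet> x = 0}"
      using False unfolding I_def by (rule card_kernel_border_mat_outside[OF A b c])
    show ?thesis
    proof (cases "c \<in> L")
      case True
      have "vec_space.rank (Suc n) ?M = s + 1"
        using K by (intro rank_eqI[OF M]) (simp add: ker zero[OF True] algebra_simps)
      then show ?thesis using not_iso True by simp
    next
      case cL: False
      have "card (mat_kernel ?M) * ?q ^ (s + 2) = (?q * card {x \<in> ?K. c \<bullet> x = 0}) * ?q ^ s * ?q"
        by (simp add: ker)
      also have "\<dots> = ?q ^ Suc m" by (simp add: level[OF cL] K)
      finally have "vec_space.rank (Suc n) ?M = s + 2" by (rule rank_eqI[OF M])
      then show ?thesis using not_iso False cL by simp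
    qed
  next
    case True
    then obtain x0 where x0: "x0 \<in> carrier_vec m" "b = A *\<^sub>v x0"
      by (auto simp: I_def col_space_eq_image[OF A])
    have ker: "card (mat_kernel ?M) = (\<Sum>t\<in>UNIV. card {y \<in> ?K. c \<bullet> y = t * (c \<bullet> x0)})"
      unfolding x0(2) by (rule card_kernel_border_mat_inside[OF A c x0(1)])
    show ?thesis
    proof (cases "c \<in> L")
      case False
      \<comment> \<open>For each last coordinate \<open>t\<close> the solutions form a level set, a \<open>q\<close>-th of the kernel; there are \<open>q\<close> choices of \<open>t\<close>.\<close>
      have "?q * card (mat_kernel ?M) = (\<Sum>t\<in>(UNIV :: 'a set). card ?K)"
        unfolding ker sum_distrib_left by (intro sum.cong level[OF False] refl)
      then have "card (mat_kernel ?M) = card ?K" by simp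
      then have "vec_space.rank (Suc n) ?M = s + 1"
        using K by (intro rank_eqI[OF M]) (simp add: algebra_simps)
      then show ?thesis using False True iso by simp
    next
      case cL: True
      have "c \<bullet> x = c \<bullet> x0" if "x \<in> carrier_vec m" "A *\<^sub>v x = b" for x
        using orthogonal_kernel_scalar_prod_cong[OF A cL[unfolded L_def] that(1) x0(1)] that x0 by simp
      then have iso': "(b, c) \<in> isotropic_borders A \<longleftrightarrow> c \<bullet> x0 = 0"
        unfolding iso using cL x0 by metis
      have "{y \<in> ?K. c \<bullet> y = t * (c \<bullet> x0)} = (if t * (c \<bullet> x0) = 0 then ?K else {})" for t
        using cL by (auto simp: L_def vec_module.orthogonal_complement_def)
      then have ker': "card (mat_kernel ?M) = (\<Sum>t\<in>UNIV. if t * (c \<bullet> x0) = 0 then card ?K else 0)"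
        unfolding ker by (intro sum.cong) auto
      show ?thesis
      proof (cases "c \<bullet> x0 = 0")
        case True
        have "vec_space.rank (Suc n) ?M = s"
          using K True by (intro rank_eqI[OF M]) (simp add: ker' algebra_simps)
        then show ?thesis using iso' True by simp
      next
        case False
        have "vec_space.rank (Suc n) ?M = s + 1"
          using K False by (intro rank_eqI[OF M]) (simp add: ker' algebra_simps)
        then show ?thesis using iso' False cL by simp
      qed
    qed
  qed
qed


lemma isotropic_borders_subset:
  assumes A: "A \<in> carrier_mat n m"
  shows "isotropic_borders A \<subseteq>
    vec_space.col_space n A \<times> vec_module.orthogonal_complement m (mat_kernel A)"
  using A by (auto simp: isotropic_borders_def col_space_eq_image[OF A])

text \<open>The borders that raise the rank by \<open>0\<close> and by \<open>2\<close> are counted directly; the rest raise it by \<open>1\<close>.\<close>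
lemma card_borders_of_rank:
  fixes A :: "'a::{field,finite} mat"
  assumes A: "A \<in> carrier_mat n m"
  defines "q \<equiv> real CARD('a)" and "s \<equiv> vec_space.rank n A"
  defines "w \<equiv> real (card (isotropic_borders A))"
  shows "real (card {(b, c) \<in> carrier_vec n \<times> carrier_vec m. vec_space.rank (Suc n) (border_mat A b c) = k}) =
    (if k = s then w
     else if k = s + 1 then q ^ (n + m) - w - (q ^ n - q ^ s) * (q ^ m - q ^ s)
     else if k = s + 2 then (q ^ n - q ^ s) * (q ^ m - q ^ s)
     else 0)" (is "real (card (?R k)) = _")
proof -
  define I where "I = vec_space.col_space n A"
  define L where "L = vec_module.orthogonal_complement m (mat_kernel A)"
  define W where "W = isotropic_borders A"
  let ?V = "carrier_vec n :: 'a vec set" and ?U = "carrier_vec m :: 'a vec set"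
  have IV: "I \<subseteq> ?V" using A by (auto simp: I_def col_space_eq_image[OF A])
  have LU: "L \<subseteq> ?U" by (auto simp: L_def vec_module.orthogonal_complement_def)
  have W: "W \<subseteq> I \<times> L" unfolding W_def I_def L_def by (rule isotropic_borders_subset[OF A])
  have fin: "finite I" "finite L" using IV LU by (auto intro: finite_subset)
  have rank: "vec_space.rank (Suc n) (border_mat A b c) =
      (if (b, c) \<in> W then s else if b \<in> I \<or> c \<in> L then s + 1 else s + 2)"
    if "b \<in> ?V" "c \<in> ?U" for b c
    using rank_border_mat[OF A that] by (simp add: W_def I_def L_def s_def)
  define T where "T = (?V - I) \<times> (?U - L)"
  have "card (?V - I) = card ?V - card I" "card (?U - L) = card ?U - card L"
    using fin IV LU by (simp_all add: card_Diff_subset)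
  moreover have "card I \<le> card ?V" "card L \<le> card ?U"
    using IV LU by (simp_all add: card_mono)
  ultimately have T: "real (card T) = (q ^ n - q ^ s) * (q ^ m - q ^ s)"
    using card_col_space[OF A] card_orthogonal_mat_kernel[OF A]
    by (simp add: T_def card_cartesian_product of_nat_diff card_carrier_vec I_def L_def q_def s_def)
  have R: "?R k = (if k = s then W else if k = s + 1 then ?V \<times> ?U - (W \<union> T)
      else if k = s + 2 then T else {})"
  proof -
    have mem: "(b, c) \<in> ?R k \<longleftrightarrow> (b, c) \<in> (if k = s then W else if k = s + 1 then ?V \<times> ?U - (W \<union> T)
      else if k = s + 2 then T else {})" for b c
    proof (cases "b \<in> ?V \<and> c \<in> ?U")
      case True
      have "(b, c) \<in> W \<longrightarrow> b \<in> I \<and> c \<in> L" using W by blast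
      with True show ?thesis by (auto simp: rank T_def)
    next
      case False
      then have "(b, c) \<notin> W" "(b, c) \<notin> T" using W IV LU unfolding T_def by blast+
      with False show ?thesis by auto
    qed
    show ?thesis by (rule Set.set_eqI, unfold split_paired_all, rule mem)
  qed
  have finWT: "finite W" "finite T"
    using finite_subset[OF W] fin by (simp_all add: T_def)
  have WT: "W \<union> T \<subseteq> ?V \<times> ?U" "W \<inter> T = {}"
    using W IV LU by (auto simp: T_def)
  have "card (?V \<times> ?U - (W \<union> T)) = card (?V \<times> ?U) - card (W \<union> T)"
    using finWT WT(1) by (intro card_Diff_subset) simp_all
  moreover have "card (W \<union> T) \<le> card (?V \<times> ?U)"
    using WT(1) by (intro card_mono) simp_all
  moreover have "card (W \<union> T) = card W + card T"
    using finWT WT(2) by (rule card_Un_disjoint)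
  ultimately have "real (card (?V \<times> ?U - (W \<union> T))) = q ^ (n + m) - w - real (card T)"
    by (simp add: of_nat_diff card_cartesian_product card_carrier_vec power_add q_def w_def W_def)
  then show ?thesis unfolding R using T by (simp add: w_def W_def)
qed

section \<open>Matrices with zero diagonal\<close>

definition zero_diag :: "nat \<Rightarrow> 'a::zero mat set" where
  "zero_diag n = {A \<in> carrier_mat n n. \<forall>i<n. A $$ (i, i) = 0}"

lemma bij_betw_border_mat:
  "bij_betw (\<lambda>(A, b, c). border_mat A b c) (zero_diag n \<times> carrier_vec n \<times> carrier_vec n)
     (zero_diag (Suc n))"
proof (rule bij_betw_byWitness[where f' = "\<lambda>M. (mat n n (\<lambda>(i, j). M $$ (i, j)),
    vec n (\<lambda>i. M $$ (i, n)), vec n (\<lambda>j. M $$ (n, j)))"])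
  show "\<forall>M\<in>zero_diag (Suc n). (case (mat n n (\<lambda>(i, j). M $$ (i, j)),
      vec n (\<lambda>i. M $$ (i, n)), vec n (\<lambda>j. M $$ (n, j))) of (A, b, c) \<Rightarrow> border_mat A b c) = M"
    by (auto simp: zero_diag_def border_mat_def less_Suc_eq intro!: eq_matI)
qed (auto simp: zero_diag_def border_mat_def less_Suc_eq intro!: eq_matI)

lemma finite_zero_diag: "finite (zero_diag n :: 'a::{zero,finite} mat set)"
proof (induction n)
  case 0
  have "(zero_diag 0 :: 'a mat set) \<subseteq> {0\<^sub>m 0 0}"
    by (auto simp: zero_diag_def)
  then show ?case by (rule finite_subset) simp
next
  case (Suc n)
  then show ?case
    using bij_betw_finite[OF bij_betw_border_mat[where ?'a = 'a and n = n]] by simp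
qed

lemma zero_diag_mats_eq:
  "zero_diag_mats TYPE('a::{field,finite}) n r = {A \<in> zero_diag n. int (vec_space.rank n A) = r}"
  by (auto simp: zero_diag_mats_def zero_diag_def)

lemma zero_diag_count_Suc:
  "zero_diag_count TYPE('a::{field,finite}) (Suc n) (int k) =
    (\<Sum>A\<in>(zero_diag n :: 'a mat set).
      card {(b, c) \<in> carrier_vec n \<times> carrier_vec n. vec_space.rank (Suc n) (border_mat A b c) = k})"
proof -
  let ?f = "\<lambda>(A :: 'a mat, b, c). border_mat A b c"
  let ?S = "SIGMA A:(zero_diag n :: 'a mat set).
    {(b, c) \<in> carrier_vec n \<times> carrier_vec n. vec_space.rank (Suc n) (border_mat A b c) = k}"
  note bij = bij_betw_border_mat[where ?'a = 'a and n = n]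
  have sub: "?S \<subseteq> zero_diag n \<times> carrier_vec n \<times> carrier_vec n" by auto
  have "zero_diag_mats TYPE('a) (Suc n) (int k) = ?f ` ?S"
  proof (intro equalityI subsetI)
    fix M assume M: "M \<in> zero_diag_mats TYPE('a) (Suc n) (int k)"
    then have "M \<in> ?f ` (zero_diag n \<times> carrier_vec n \<times> carrier_vec n)"
      unfolding bij_betw_imp_surj_on[OF bij] by (simp add: zero_diag_mats_eq)
    then show "M \<in> ?f ` ?S" using M by (force simp: zero_diag_mats_eq)
  next
    fix M assume "M \<in> ?f ` ?S"
    moreover from this have "M \<in> zero_diag (Suc n)"
      using bij_betw_imp_surj_on[OF bij] sub by blast
    ultimately show "M \<in> zero_diag_mats TYPE('a) (Suc n) (int k)" by (auto simp: zero_diag_mats_eq)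
  qed
  then have "zero_diag_count TYPE('a) (Suc n) (int k) = card ?S"
    unfolding zero_diag_count_def
    using card_image[OF inj_on_subset[OF bij_betw_imp_inj_on[OF bij] sub]] by simp
  also have "\<dots> = (\<Sum>A\<in>(zero_diag n :: 'a mat set).
      card {(b, c) \<in> carrier_vec n \<times> carrier_vec n. vec_space.rank (Suc n) (border_mat A b c) = k})"
  proof (rule card_SigmaI[OF finite_zero_diag], rule ballI)
    fix A :: "'a mat"
    show "finite {(b, c) \<in> carrier_vec n \<times> carrier_vec n. vec_space.rank (Suc n) (border_mat A b c) = k}"
      by (rule finite_subset[of _ "carrier_vec n \<times> carrier_vec n"]) auto
  qed
  finally show ?thesis .
qed

text \<open>The exponents \<open>2 s - 1\<close> and \<open>s - 1\<close> are negative for \<open>s = 0\<close>, where the two terms cancel and the count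
  is \<open>1\<close>.\<close>
lemma powi_isotropic_borders:
  fixes A :: "'a::{field,finite} mat"
  assumes A: "A \<in> carrier_mat n m"
  defines "q \<equiv> real CARD('a)" and "s \<equiv> int (vec_space.rank n A)"
  shows "real (card (isotropic_borders A)) = q powi (2 * s - 1) + q powi s - q powi (s - 1)"
proof -
  let ?s = "vec_space.rank n A" and ?w = "real (card (isotropic_borders A))"
  have q: "q > 0" by (simp add: q_def)
  have "real (CARD('a) * card (isotropic_borders A) + CARD('a) ^ ?s) =
      real (CARD('a) ^ (2 * ?s) + CARD('a) ^ (?s + 1))"
    by (simp only: card_isotropic_borders[OF A])
  then have "q * ?w = q ^ (2 * ?s) + q ^ (?s + 1) - q ^ ?s" by (simp add: q_def)
  moreover have "q * q powi (2 * s - 1) = q ^ (2 * ?s)" "q * q powi (s - 1) = q ^ ?s" "q powi s = q ^ ?s"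
    using q unfolding s_def by (simp_all add: power_int_diff flip: power_int_of_nat)
  ultimately have "q * ?w = q * (q powi (2 * s - 1) + q powi s - q powi (s - 1))"
    by (simp add: distrib_left right_diff_distrib)
  then show ?thesis using q by simp
qed

text \<open>A matrix of rank \<open>0\<close> has a column space with one element, hence is the zero matrix.\<close>
lemma zero_diag_count_0: "zero_diag_count TYPE('a::{field,finite}) n 0 = 1"
proof -
  have "A = 0\<^sub>m n n" if A: "A \<in> carrier_mat n n" and r: "vec_space.rank n A = 0" for A :: "'a mat"
  proof -
    have "card ((\<lambda>x. A *\<^sub>v x) ` carrier_vec n) = 1"
      using card_col_space[OF A] r by (simp add: col_space_eq_image[OF A])
    then obtain b where b: "(\<lambda>x. A *\<^sub>v x) ` carrier_vec n = {b}" by (auto simp: card_1_singleton_iff)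
    have "A *\<^sub>v 0\<^sub>v n = 0\<^sub>v n" using A by auto
    then have "b = 0\<^sub>v n" using b by (metis image_eqI singletonD zero_carrier_vec)
    show ?thesis
    proof (rule eq_matI)
      fix i j assume ij: "i < dim_row (0\<^sub>m n n :: 'a mat)" "j < dim_col (0\<^sub>m n n :: 'a mat)"
      then have "A *\<^sub>v unit_vec n j = 0\<^sub>v n" using b \<open>b = 0\<^sub>v n\<close> by auto
      then have "(A *\<^sub>v unit_vec n j) $ i = 0" using ij by simp
      then show "A $$ (i, j) = 0\<^sub>m n n $$ (i, j)" using A ij by simp
    qed (use A in auto)
  qed
  moreover have "vec_space.rank n (0\<^sub>m n n :: 'a mat) = 0" by (rule vec_space.rank_0I)
  ultimately have "zero_diag_mats TYPE('a) n 0 = {0\<^sub>m n n}"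
    by (auto simp: zero_diag_mats_def)
  then show ?thesis by (simp add: zero_diag_count_def)
qed

lemma sum_rank_eq:
  "(\<Sum>A\<in>(zero_diag n :: 'a::{field,finite} mat set). if int (vec_space.rank n A) = r then w else 0) =
    w * real (zero_diag_count TYPE('a) n r)"
  by (simp add: sum.If_cases[OF finite_zero_diag] zero_diag_count_def zero_diag_mats_eq Int_def conj_commute)

theorem corollary2p13:
  fixes q n :: nat and r :: int
  assumes "CARD('a::{field,finite}) = q" and "n \<ge> 1" and "r \<ge> 0"
  shows "real (zero_diag_count TYPE('a) (n + 1) (r + 1)) =
      (real q powi int n - real q powi (r - 1))\<^sup>2 * real (zero_diag_count TYPE('a) n (r - 1))
    + (real q powi (2 * r + 1) + real q powi (r + 1) - real q powi r) * real (zero_diag_count TYPE('a) n (r + 1))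
    + (2 * real q powi (int n + r) - real q powi (2 * r) - real q powi (2 * r - 1)
        - real q powi r + real q powi (r - 1)) * real (zero_diag_count TYPE('a) n r)
    \<and> zero_diag_count TYPE('a) n 0 = 1
    \<and> zero_diag_count TYPE('a) n (- 1) = 0
    \<and> zero_diag_count TYPE('a) 1 1 = 0"
proof -
  let ?q = "real q" and ?g = "zero_diag_count TYPE('a)"
  let ?\<alpha> = "(?q powi int n - ?q powi (r - 1))\<^sup>2"
  let ?\<gamma> = "?q powi (2 * r + 1) + ?q powi (r + 1) - ?q powi r"
  let ?\<beta> = "2 * ?q powi (int n + r) - ?q powi (2 * r) - ?q powi (2 * r - 1) - ?q powi r + ?q powi (r - 1)"
  have q: "?q > 0" using two_le_card_field[where ?'a = 'a] assms(1) by simp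
  \<comment> \<open>Ranks of matrices are natural numbers, and \<open>r + 1 \<ge> 0\<close>.\<close>
  define k where "k = nat (r + 1)"
  have k: "int k = r + 1" using assms(3) by (simp add: k_def)
  have borders: "real (card {(b, c) \<in> carrier_vec n \<times> carrier_vec n.
        vec_space.rank (Suc n) (border_mat A b c) = k}) =
      (if int (vec_space.rank n A) = r - 1 then ?\<alpha> else 0) +
      (if int (vec_space.rank n A) = r + 1 then ?\<gamma> else 0) +
      (if int (vec_space.rank n A) = r then ?\<beta> else 0)" (is "real (card ?R) = _")
    if "A \<in> zero_diag n" for A :: "'a mat"
  proof -
    have A: "A \<in> carrier_mat n n" using that by (simp add: zero_diag_def)
    define s where "s = vec_space.rank n A"
    note iso = powi_isotropic_borders[OF A, unfolded assms(1), folded s_def]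
    note R = card_borders_of_rank[OF A, unfolded assms(1), folded s_def, of k]
    consider "int s = r - 1" | "int s = r" | "int s = r + 1" | "int s \<notin> {r - 1, r, r + 1}" by blast
    then show ?thesis
    proof cases
      case 1
      then have "k = s + 2" using k by linarith
      then have "real (card ?R) = (?q ^ n - ?q ^ s)\<^sup>2" using R by (simp add: power2_eq_square)
      also have "?q ^ s = ?q powi (r - 1)" by (simp flip: 1)
      finally show ?thesis using 1 by (simp add: s_def)
    next
      case 2
      then have "k = s + 1" using k by linarith
      then have "real (card ?R) = ?q ^ (n + n) - (?q powi (2 * r - 1) + ?q powi r - ?q powi (r - 1))
          - (?q ^ n - ?q ^ s) * (?q ^ n - ?q ^ s)" using R iso 2 by simp
      also have "\<dots> = ?\<beta>"
      proof -
        have "?q ^ s = ?q powi r" by (simp flip: 2)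
        moreover have "?q powi (int n + r) = ?q ^ n * ?q powi r"
          using q power_int_add[of ?q "int n" r] by simp
        moreover have "?q powi (2 * r) = ?q powi r * ?q powi r"
          using q power_int_add[of ?q r r] unfolding mult_2 by simp
        ultimately show ?thesis
          by (simp only: power_add) (simp add: left_diff_distrib right_diff_distrib mult.commute)
      qed
      finally show ?thesis using 2 by (simp add: s_def)
    next
      case 3
      then have "k = s" using k by linarith
      moreover have "2 * (r + 1) - 1 = 2 * r + 1" "r + 1 - 1 = r" by simp_all
      note iso[unfolded 3 this]
      ultimately have "real (card ?R) = ?\<gamma>" using R by simp
      then show ?thesis using 3 by (simp add: s_def)
    next
      case 4
      then have "k \<noteq> s" "k \<noteq> s + 1" "k \<noteq> s + 2" using k by auto
      then show ?thesis using R 4 by (simp add: s_def)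
    qed
  qed
  have "real (?g (n + 1) (r + 1)) = (\<Sum>A\<in>(zero_diag n :: 'a mat set).
      real (card {(b, c) \<in> carrier_vec n \<times> carrier_vec n. vec_space.rank (Suc n) (border_mat A b c) = k}))"
    using zero_diag_count_Suc[of n k, where ?'a = 'a] by (simp add: k)
  also have "\<dots> = ?\<alpha> * real (?g n (r - 1)) + ?\<gamma> * real (?g n (r + 1)) + ?\<beta> * real (?g n r)"
    by (simp only: sum.cong[OF refl borders] sum.distrib sum_rank_eq)
  finally have rec: "real (?g (n + 1) (r + 1)) =
    ?\<alpha> * real (?g n (r - 1)) + ?\<gamma> * real (?g n (r + 1)) + ?\<beta> * real (?g n r)" .
  have neg: "?g n (- 1) = 0" by (simp add: zero_diag_count_def zero_diag_mats_def)
  have "zero_diag_mats TYPE('a) 1 1 \<subseteq> {A \<in> {0\<^sub>m 1 1}. vec_space.rank 1 A = 1}"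
    by (auto simp: zero_diag_mats_def intro!: eq_matI)
  also have "\<dots> = {}" using vec_space.rank_0I[of 1 1, where ?'a = 'a] by auto
  finally have "?g 1 1 = 0" by (simp add: zero_diag_count_def)
  with rec neg zero_diag_count_0 show ?thesis by blast
qed

end
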